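(* If a quaternion function $\varphi$ is $\mathbb{H}$-differentiable at a point $z^0\in\mathbb{H}$ and $\varphi\neq0$ in a neighborhood of $z^0$, then $\frac{1}{\varphi}$ is also $\mathbb{H}$-differentiable at $z^0$ and $$\left(\frac{1}{\varphi}\right)'(z^0)=-\frac{1}{\varphi(z^0)}\cdot\varphi'(z^0)\cdot\frac{1}{\varphi(z^0)}.$$
   Context: $\mathbb{H}$ denotes the algebra of real quaternions with its usual norm $|\cdot|$; for a quaternion $q\neq0$, $\frac1q=q^{-1}$ is its inverse. A quaternion function $f$ defined on a neighborhood $G\subset\mathbb{H}$ of a point $z^0$ is called $\mathbb{H}$-differentiable at $z^0$ if there exist two (finite or infinite) sequences of quaternions $A_k=A_k(z^0)$, $B_k=B_k(z^0)$ such that $\sum_k A_kB_k$ is finite (converges) and, for $z^0+h\in G$, $$f(z^0+h)-f(z^0)=\sum_k A_k\, h\, B_k+\omega(z^0,h),\qquad \lim_{h\to0}\frac{|\omega(z^0,h)|}{|h|}=0.$$ In this case the quaternion $f'(z^0)=\sum_k A_kB_k$ is called the $\mathbb{H}$-derivative of $f$ at $z^0$. *)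

theory Defs
  imports "HOL-Analysis.Analysis"
begin

datatype quat = Quat (qRe: real) (qI: real) (qJ: real) (qK: real)

lemma quat_eq_iff: "x = y \<longleftrightarrow> qRe x = qRe y \<and> qI x = qI y \<and> qJ x = qJ y \<and> qK x = qK y"
  by (cases x; cases y) simp

instantiation quat :: real_vector
begin

definition "0 = Quat 0 0 0 0"

definition "x + y = Quat (qRe x + qRe y) (qI x + qI y) (qJ x + qJ y) (qK x + qK y)"

definition "- x = Quat (- qRe x) (- qI x) (- qJ x) (- qK x)"

definition "x - y = Quat (qRe x - qRe y) (qI x - qI y) (qJ x - qJ y) (qK x - qK y)"

definition "scaleR r x = Quat (r * qRe x) (r * qI x) (r * qJ x) (r * qK x)"

instance
  by standard
    (simp_all add: quat_eq_iff zero_quat_def plus_quat_def uminus_quat_def minus_quat_def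
      scaleR_quat_def algebra_simps)

end

instantiation quat :: real_inner
begin

definition "inner x y = qRe x * qRe y + qI x * qI y + qJ x * qJ y + qK x * qK y"

definition "norm (x::quat) = sqrt ((qRe x)\<^sup>2 + (qI x)\<^sup>2 + (qJ x)\<^sup>2 + (qK x)\<^sup>2)"

definition "sgn (x::quat) = x /\<^sub>R norm x"

definition "dist (x::quat) y = norm (x - y)"

definition "(uniformity :: (quat \<times> quat) filter) =
  (INF e\<in>{0<..}. principal {(x, y). dist x y < e})"

definition "open (U :: quat set) \<longleftrightarrow>
  (\<forall>x\<in>U. eventually (\<lambda>(x', y). x' = x \<longrightarrow> y \<in> U) uniformity)"

instance
proof
  fix x y z :: quat and r :: real
  have sq: "inner x x = (qRe x)\<^sup>2 + (qI x)\<^sup>2 + (qJ x)\<^sup>2 + (qK x)\<^sup>2"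
    by (simp add: inner_quat_def power2_eq_square)
  show "inner x y = inner y x"
    by (simp add: inner_quat_def mult.commute)
  show "inner (x + y) z = inner x z + inner y z"
    by (simp add: inner_quat_def plus_quat_def algebra_simps)
  show "inner (r *\<^sub>R x) y = r * inner x y"
    by (simp add: inner_quat_def scaleR_quat_def algebra_simps)
  show "0 \<le> inner x x"
    by (simp add: sq)
  show "inner x x = 0 \<longleftrightarrow> x = 0"
    by (simp add: sq quat_eq_iff zero_quat_def add_nonneg_eq_0_iff)
  show "norm x = sqrt (inner x x)"
    by (simp add: sq norm_quat_def)
qed (rule sgn_quat_def dist_quat_def uniformity_quat_def open_quat_def)+

end

instantiation quat :: real_normed_div_algebra
begin

definition "1 = Quat 1 0 0 0"

definition "x * y = Quat
  (qRe x * qRe y - qI x * qI y - qJ x * qJ y - qK x * qK y)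
  (qRe x * qI y + qI x * qRe y + qJ x * qK y - qK x * qJ y)
  (qRe x * qJ y - qI x * qK y + qJ x * qRe y + qK x * qI y)
  (qRe x * qK y + qI x * qJ y - qJ x * qI y + qK x * qRe y)"

definition "inverse (x::quat) =
  (let n = (qRe x)\<^sup>2 + (qI x)\<^sup>2 + (qJ x)\<^sup>2 + (qK x)\<^sup>2
   in Quat (qRe x / n) (- qI x / n) (- qJ x / n) (- qK x / n))"

definition "x div y = x * inverse (y::quat)"

instance
proof
  fix x y z :: quat and r :: real
  show "x * y * z = x * (y * z)" "(x + y) * z = x * z + y * z" "x * (y + z) = x * y + x * z"
    by (simp_all add: quat_eq_iff times_quat_def plus_quat_def algebra_simps)
  show "1 * x = x" "x * 1 = x" "(0::quat) \<noteq> 1"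
    by (simp_all add: quat_eq_iff times_quat_def one_quat_def zero_quat_def)
  show "r *\<^sub>R x * y = r *\<^sub>R (x * y)" "x * r *\<^sub>R y = r *\<^sub>R (x * y)"
    by (simp_all add: quat_eq_iff times_quat_def scaleR_quat_def algebra_simps)
  show "inverse (0::quat) = 0"
    by (simp add: inverse_quat_def zero_quat_def)
  show "x div y = x * inverse y"
    by (rule divide_quat_def)
  show "norm (x * y) = norm x * norm y"
    unfolding norm_quat_def real_sqrt_mult[symmetric]
    by (simp add: times_quat_def power2_eq_square algebra_simps)
  let ?n = "(qRe x)\<^sup>2 + (qI x)\<^sup>2 + (qJ x)\<^sup>2 + (qK x)\<^sup>2"
  assume "x \<noteq> 0"
  then have n: "?n \<noteq> 0"
    by (auto simp: quat_eq_iff zero_quat_def add_nonneg_eq_0_iff)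
  have inv: "inverse x = inverse ?n *\<^sub>R Quat (qRe x) (- qI x) (- qJ x) (- qK x)"
    by (simp add: inverse_quat_def scaleR_quat_def Let_def divide_inverse mult.commute)
  have c: "inverse ?n * (qRe x * qRe x) + inverse ?n * (qI x * qI x)
      + inverse ?n * (qJ x * qJ x) + inverse ?n * (qK x * qK x) = 1"
    using n by (simp add: power2_eq_square flip: distrib_left)
  show "inverse x * x = 1" "x * inverse x = 1"
    unfolding inv using c
    by (simp_all add: quat_eq_iff times_quat_def scaleR_quat_def one_quat_def
        power2_eq_square algebra_simps)
qed

end

text \<open>\<open>f\<close> is a function on the neighborhood \<open>G\<close> of \<open>z\<close>; its values outside \<open>G\<close> are irrelevant.
  Finite sequences \<open>A\<close>, \<open>B\<close> are covered by padding them with zeros.\<close>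

definition has_H_derivative ::
    "(quat \<Rightarrow> quat) \<Rightarrow> quat set \<Rightarrow> quat \<Rightarrow> quat \<Rightarrow> bool" where
  "has_H_derivative f G z D \<longleftrightarrow>
     z \<in> interior G \<and>
     (\<exists>(A :: nat \<Rightarrow> quat) (B :: nat \<Rightarrow> quat) (\<omega> :: quat \<Rightarrow> quat).
        (\<lambda>k. A k * B k) sums D \<and>
        (\<forall>h. z + h \<in> G \<longrightarrow>
           summable (\<lambda>k. A k * h * B k) \<and>
           f (z + h) - f z = (\<Sum>k. A k * h * B k) + \<omega> h) \<and>
        ((\<lambda>h. norm (\<omega> h) / norm h) \<longlongrightarrow> 0) (at 0))"

definition H_differentiable :: "(quat \<Rightarrow> quat) \<Rightarrow> quat set \<Rightarrow> quat \<Rightarrow> bool" where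
  "H_differentiable f G z \<longleftrightarrow> (\<exists>D. has_H_derivative f G z D)"

definition H_deriv :: "(quat \<Rightarrow> quat) \<Rightarrow> quat set \<Rightarrow> quat \<Rightarrow> quat" where
  "H_deriv f G z = (THE D. has_H_derivative f G z D)"

text \<open>The derivative does not depend on the choice of \<open>A\<close> and \<open>B\<close>: increments along the
  real axis determine it.\<close>

lemma has_H_derivative_real_increment:
  assumes "has_H_derivative f G z D"
  shows "((\<lambda>t::real. f (z + of_real t)) has_vector_derivative D) (at 0)"
proof -
  obtain A B \<omega> where z: "z \<in> interior G" and D: "(\<lambda>k. A k * B k) sums D"
    and f: "\<And>h. z + h \<in> G \<Longrightarrow> f (z + h) - f z = (\<Sum>k. A k * h * B k) + \<omega> h"
    and \<omega>: "((\<lambda>h. norm (\<omega> h) / norm h) \<longlongrightarrow> 0) (at 0)"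
    using assms unfolding has_H_derivative_def by blast
  have inc: "f (z + of_real t) - f z = t *\<^sub>R D + \<omega> (of_real t)" if "z + of_real t \<in> G" for t
  proof -
    have "(\<lambda>k. A k * of_real t * B k) = (\<lambda>k. t *\<^sub>R (A k * B k))"
      by (simp add: of_real_def)
    then have "(\<Sum>k. A k * of_real t * B k) = t *\<^sub>R D"
      using sums_scaleR_right[OF D, of t] by (simp add: sums_iff)
    then show ?thesis using f[OF that] by simp
  qed
  have lim: "((\<lambda>t::real. z + of_real t) \<longlongrightarrow> z) (at 0)"
    by (auto intro!: tendsto_eq_intros)
  have ev: "eventually (\<lambda>t::real. z + of_real t \<in> G) (at 0)"
    using topological_tendstoD[OF lim open_interior z]
    by (rule eventually_mono) (use interior_subset in blast)
  have "filterlim (of_real :: real \<Rightarrow> quat) (at 0) (at 0)"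
    by (rule filterlim_atI) (auto intro!: tendsto_eq_intros simp: eventually_at_filter)
  from filterlim_compose[OF \<omega> this]
  have "((\<lambda>t::real. norm (\<omega> (of_real t)) / norm t) \<longlongrightarrow> 0) (at 0)"
    by simp
  moreover have "eventually (\<lambda>t. norm (\<omega> (of_real t)) / norm t =
      norm (f (z + of_real (0 + t)) - f (z + of_real 0) - t *\<^sub>R D) / norm t) (at 0)"
    using ev by (rule eventually_mono) (simp add: inc)
  ultimately have "((\<lambda>t. norm (f (z + of_real (0 + t)) - f (z + of_real 0) - t *\<^sub>R D) / norm t)
      \<longlongrightarrow> 0) (at 0)"
    by (rule Lim_transform_eventually)
  then show ?thesis
    unfolding has_vector_derivative_def has_derivative_at
    by (simp add: bounded_linear_scaleR_left)
qed

lemma has_H_derivative_unique: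
  assumes "has_H_derivative f G z D" and "has_H_derivative f G z D'"
  shows "D = D'"
  using assms[THEN has_H_derivative_real_increment] by (rule vector_derivative_unique_at)

lemma has_H_derivative_imp_H_deriv: "has_H_derivative f G z D \<Longrightarrow> H_deriv f G z = D"
  unfolding H_deriv_def by (blast intro: has_H_derivative_unique)

end

theory Submission
  imports Defs
begin

text \<open>An \<open>\<bbbH>\<close>-derivative is a Frechet derivative of the special form
  \<open>h \<mapsto> \<Sum>k. A k * h * B k\<close>. The Frechet derivative of the reciprocal,
  \<open>h \<mapsto> - inverse (\<phi> z) * \<phi>' h * inverse (\<phi> z)\<close>, keeps this form: multiply all \<open>A k\<close> from
  the left and all \<open>B k\<close> from the right.\<close>

lemma abs_components_le_norm:
  "\<bar>qRe h\<bar> \<le> norm h" "\<bar>qI h\<bar> \<le> norm h" "\<bar>qJ h\<bar> \<le> norm h" "\<bar>qK h\<bar> \<le> norm h"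
  unfolding norm_quat_def by (auto intro!: real_le_rsqrt)

text \<open>Finite dimension gives boundedness: expand \<open>h\<close> in the basis 1, i, j, k.
  Each coordinate is at most \<open>norm h\<close>, so the sum of the norms of the four basis images
  is a bound.\<close>

lemma linear_quat_imp_bounded_linear:
  fixes L :: "quat \<Rightarrow> 'a::real_normed_vector"
  assumes "linear L"
  shows "bounded_linear L"
proof -
  interpret linear L by fact
  let ?i = "Quat 0 1 0 0" and ?j = "Quat 0 0 1 0" and ?k = "Quat 0 0 0 1"
  have "norm (L h) \<le> norm h * (norm (L 1) + norm (L ?i) + norm (L ?j) + norm (L ?k))" for h
  proof -
    have "h = qRe h *\<^sub>R 1 + qI h *\<^sub>R ?i + qJ h *\<^sub>R ?j + qK h *\<^sub>R ?k"
      by (simp add: quat_eq_iff plus_quat_def scaleR_quat_def one_quat_def)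
    then have "L h = qRe h *\<^sub>R L 1 + qI h *\<^sub>R L ?i + qJ h *\<^sub>R L ?j + qK h *\<^sub>R L ?k"
      by (metis add scaleR)
    also have "norm \<dots> \<le> \<bar>qRe h\<bar> * norm (L 1) + \<bar>qI h\<bar> * norm (L ?i)
        + \<bar>qJ h\<bar> * norm (L ?j) + \<bar>qK h\<bar> * norm (L ?k)"
      by (intro norm_triangle_le add_mono) auto
    also have "\<dots> \<le> norm h * norm (L 1) + norm h * norm (L ?i)
        + norm h * norm (L ?j) + norm h * norm (L ?k)"
      by (intro add_mono mult_right_mono abs_components_le_norm norm_ge_zero)
    finally show ?thesis by (simp add: algebra_simps)
  qed
  then show ?thesis by unfold_locales blast
qed

text \<open>Pointwise convergence makes the sum linear, and linearity on \<open>quat\<close> already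
  implies continuity, so no estimate on the coefficients enters.\<close>

lemma bounded_linear_suminf_mult:
  fixes A B :: "nat \<Rightarrow> quat"
  assumes "\<And>h. summable (\<lambda>k. A k * h * B k)"
  shows "bounded_linear (\<lambda>h. \<Sum>k. A k * h * B k)"
proof (intro linear_quat_imp_bounded_linear linearI)
  fix x y :: quat and r :: real
  show "(\<Sum>k. A k * (x + y) * B k) = (\<Sum>k. A k * x * B k) + (\<Sum>k. A k * y * B k)"
    using suminf_add[OF assms assms, of x y] by (simp add: algebra_simps)
  show "(\<Sum>k. A k * (r *\<^sub>R x) * B k) = r *\<^sub>R (\<Sum>k. A k * x * B k)"
    using suminf_scaleR_right[OF assms, of r x] by simp
qed

text \<open>This gives access to the calculus of Frechet derivatives. On the right the domain
  \<open>G\<close> occurs only through \<open>z \<in> interior G\<close>, which later permits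
  passing from \<open>G\<close> to \<open>U\<close>.\<close>

lemma has_H_derivative_iff_has_derivative:
  "has_H_derivative f G z D \<longleftrightarrow> z \<in> interior G \<and>
    (\<exists>A B. (\<lambda>k. A k * B k) sums D \<and> (\<forall>h. summable (\<lambda>k. A k * h * B k)) \<and>
      (f has_derivative (\<lambda>h. \<Sum>k. A k * h * B k)) (at z))"
proof
  assume "has_H_derivative f G z D"
  then obtain A B \<omega> where z: "z \<in> interior G" and D: "(\<lambda>k. A k * B k) sums D"
    and sf: "\<forall>h. z + h \<in> G \<longrightarrow> summable (\<lambda>k. A k * h * B k) \<and>
      f (z + h) - f z = (\<Sum>k. A k * h * B k) + \<omega> h"
    and \<omega>: "((\<lambda>h. norm (\<omega> h) / norm h) \<longlongrightarrow> 0) (at 0)"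
    unfolding has_H_derivative_def by (elim conjE exE)
  \<comment> \<open>The filter is arbitrary because this serves both for real \<open>t\<close>
    tending to 0 from the right and for quaternions \<open>h\<close> tending to 0.\<close>
  have ev: "eventually (\<lambda>x. z + g x \<in> G) F" if "(g \<longlongrightarrow> 0) F"
    for g :: "'b \<Rightarrow> quat" and F
  proof -
    have "((\<lambda>x. z + g x) \<longlongrightarrow> z) F"
      using tendsto_add[OF tendsto_const that, of z] by simp
    from topological_tendstoD[OF this open_interior z] show ?thesis
      by (rule eventually_mono) (use interior_subset in blast)
  qed
  \<comment> \<open>Convergence is given only when \<open>z + h\<close> lies in \<open>G\<close>.
    Any other \<open>h\<close> is shrunk by a small real \<open>t > 0\<close>, which commutes with
    quaternions and can be divided out of the series.\<close>
  have summable: "summable (\<lambda>k. A k * h * B k)" for h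
  proof -
    have "((\<lambda>t. t *\<^sub>R h) \<longlongrightarrow> 0) (at_right 0)"
      by (auto intro!: tendsto_eq_intros)
    then have "eventually (\<lambda>t. t > 0 \<and> z + t *\<^sub>R h \<in> G) (at_right 0)"
      by (intro eventually_conj eventually_at_right_less ev)
    from eventually_happens'[OF trivial_limit_at_right_real this]
    obtain t :: real where "t > 0" "z + t *\<^sub>R h \<in> G"
      by (elim exE conjE)
    with sf have "summable (\<lambda>k. t *\<^sub>R (A k * h * B k))"
      by fastforce
    from summable_scaleR_right[OF this, of "inverse t"] \<open>t > 0\<close> show ?thesis
      by simp
  qed
  have "eventually (\<lambda>h. z + h \<in> G) (at 0)"
    using ev[OF tendsto_ident_at] by simp
  \<comment> \<open>\<open>\<omega>\<close> is tied to \<open>f\<close> only where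
    \<open>z + h\<close> lies in \<open>G\<close>, so it agrees with the true remainder only near 0;
    the limit needs no more.\<close>
  then have "eventually (\<lambda>h. norm (\<omega> h) / norm h =
      norm (f (z + h) - f z - (\<Sum>k. A k * h * B k)) / norm h) (at 0)"
    by (rule eventually_mono) (simp add: sf)
  with \<omega> have "((\<lambda>h. norm (f (z + h) - f z - (\<Sum>k. A k * h * B k)) / norm h) \<longlongrightarrow> 0) (at 0)"
    by (rule Lim_transform_eventually)
  then have "(f has_derivative (\<lambda>h. \<Sum>k. A k * h * B k)) (at z)"
    by (simp add: has_derivative_at bounded_linear_suminf_mult summable)
  with z D summable show "z \<in> interior G \<and>
    (\<exists>A B. (\<lambda>k. A k * B k) sums D \<and> (\<forall>h. summable (\<lambda>k. A k * h * B k)) \<and>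
      (f has_derivative (\<lambda>h. \<Sum>k. A k * h * B k)) (at z))"
    by blast
next
  assume "z \<in> interior G \<and>
    (\<exists>A B. (\<lambda>k. A k * B k) sums D \<and> (\<forall>h. summable (\<lambda>k. A k * h * B k)) \<and>
      (f has_derivative (\<lambda>h. \<Sum>k. A k * h * B k)) (at z))"
  then obtain A B where "z \<in> interior G" "(\<lambda>k. A k * B k) sums D"
    and "\<forall>h. summable (\<lambda>k. A k * h * B k)"
    and "(f has_derivative (\<lambda>h. \<Sum>k. A k * h * B k)) (at z)"
    by blast
  \<comment> \<open>Taking the whole remainder as \<open>\<omega>\<close> makes the expansion an
    identity; its decay is the Frechet condition.\<close>
  then show "has_H_derivative f G z D"
    unfolding has_H_derivative_def has_derivative_at
    by (intro conjI exI[of _ A] exI[of _ B]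
        exI[of _ "\<lambda>h. f (z + h) - f z - (\<Sum>k. A k * h * B k)"]) auto
qed

lemma has_H_derivative_inverse:
  assumes "has_H_derivative f G z D" "z \<in> interior U" "f z \<noteq> 0"
  shows "has_H_derivative (\<lambda>x. inverse (f x)) U z (- inverse (f z) * D * inverse (f z))"
proof -
  obtain A B where D: "(\<lambda>k. A k * B k) sums D"
    and s: "\<And>h. summable (\<lambda>k. A k * h * B k)"
    and f: "(f has_derivative (\<lambda>h. \<Sum>k. A k * h * B k)) (at z)"
    using assms(1) unfolding has_H_derivative_iff_has_derivative by blast
  let ?c = "inverse (f z)"
  let ?A = "\<lambda>k. - ?c * A k" and ?B = "\<lambda>k. B k * ?c"
  \<comment> \<open>Used twice: \<open>h = 1\<close> yields the value of the derivative, general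
    \<open>h\<close> identifies the new series with the Frechet derivative of the
    reciprocal.\<close>
  have sums: "(\<lambda>k. ?A k * h * ?B k) sums (- (?c * S * ?c))"
    if "(\<lambda>k. A k * h * B k) sums S" for h S
    using sums_mult2[OF sums_mult[OF that, of "- ?c"], of ?c] by (simp add: mult.assoc)
  have "(\<lambda>k. ?A k * ?B k) sums (- ?c * D * ?c)"
    using sums[of 1 D] D by simp
  moreover have "summable (\<lambda>k. ?A k * h * ?B k)" for h
    using sums[OF summable_sums[OF s]] by (rule sums_summable)
  moreover have "((\<lambda>x. inverse (f x)) has_derivative (\<lambda>h. \<Sum>k. ?A k * h * ?B k)) (at z)"
    using Deriv.has_derivative_inverse[OF assms(3) f]
    unfolding sums_unique[OF sums[OF summable_sums[OF s]], symmetric] .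
  ultimately show ?thesis
    unfolding has_H_derivative_iff_has_derivative using assms(2)
    by (intro conjI exI[of _ ?A] exI[of _ ?B]) auto
qed

theorem proposition3p5:
  fixes \<phi> :: "quat \<Rightarrow> quat" and G U :: "quat set" and z0 :: quat
  assumes "H_differentiable \<phi> G z0"
    and "U \<subseteq> G" and "z0 \<in> interior U" and "\<And>z. z \<in> U \<Longrightarrow> \<phi> z \<noteq> 0"
  shows "H_differentiable (\<lambda>z. 1 / \<phi> z) U z0 \<and>
    H_deriv (\<lambda>z. 1 / \<phi> z) U z0 = - (1 / \<phi> z0) * H_deriv \<phi> G z0 * (1 / \<phi> z0)"
proof -
  obtain D where D: "has_H_derivative \<phi> G z0 D"
    using assms(1) unfolding H_differentiable_def by blast
  have "\<phi> z0 \<noteq> 0"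
    using assms(3,4) interior_subset by blast
  with D assms(3)
  have "has_H_derivative (\<lambda>z. 1 / \<phi> z) U z0 (- (1 / \<phi> z0) * D * (1 / \<phi> z0))"
    using has_H_derivative_inverse by (simp add: divide_inverse)
  \<comment> \<open>\<open>H_deriv\<close> is a definite description, so uniqueness of the
    derivative is what evaluates it, for \<open>\<phi>\<close> on \<open>G\<close> and for the
    reciprocal on \<open>U\<close>.\<close>
  then show ?thesis
    using D has_H_derivative_imp_H_deriv unfolding H_differentiable_def by blast
qed

end
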